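(* Let $\alpha,\ell>0$. Let $(\bar{n}_m)_{m=1}^\infty$ be a strictly increasing sequence of positive integers and $(Y_m)_{m=1}^\infty$ a sequence of sets such that each $Y_m\subset(0,1)$ consists of $\bar{n}_m$ distinct points and, for some constant $c_{\mathrm{qu}}>0$, the quasi-uniformity condition $$h_{Y_m,(0,1)}\le c_{\mathrm{qu}}\,\bar{n}_m^{-1}$$ holds for every $m\ge1$. For $p,q\in\mathbb{N}$ let $Y_p^{q,+}=\{x+q-1 : x\in Y_p\}$, $Y_p^{q,-}=\{x-q : x\in Y_p\}$ and $$X_k=\bigcup_{m=1}^k\left(Y_{k-m+1}^{m,+}\cup Y_{k-m+1}^{m,-}\right),$$ so that $n=\#X_k=2\sum_{m=1}^k\bar{n}_m$. Let $C>0$ and $h_0\in(0,1]$ be constants, depending only on $\ell$, such that for every closed interval $\Omega\subset\mathbb{R}$ of length $1$ and every finite set $X\subset\mathbb{R}$ of distinct points $$\|P_{\ell,X}\|_{L^1(\Omega)}\le\exp\left(C\log(h_{X,\Omega})\,h_{X,\Omega}^{-1}\right)\quad\text{whenever } h_{X,\Omega}\le h_0$$ (such constants exist), and let $\bar{h}_0=\min\{h_0,c_{\mathrm{qu}}^{-1}\}$. If $k\ge c_{\mathrm{qu}}\bar{h}_0^{-1}$, then $$e_{\alpha,\ell}(Q^{\mathrm{opt}}_{\alpha,\ell,X_k})\le\exp\left(-\frac{g(k)^2}{2\alpha^2}\right)+C_1\sum_{m=k-g(k)+1}^k\exp\left(-\left[\frac{(k-m)^2}{2\alpha^2}+C_2\,\bar{n}_m\log(\bar{n}_m)\right]\right),$$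 where $g(k)=\lfloor k+1-c_{\mathrm{qu}}\bar{h}_0^{-1}\rfloor$, $C_1=\frac{\sqrt{2}}{\sqrt{\pi}\,\alpha}$ and $C_2=\frac{C}{2c_{\mathrm{qu}}}$.
   Context: $I_\alpha(f)=\frac{1}{\sqrt{2\pi}\,\alpha}\int_{\mathbb{R}}f(x)\exp(-x^2/(2\alpha^2))\,dx$; $K_\ell(x,y)=\exp(-(x-y)^2/(2\ell^2))$ on $\mathbb{R}\times\mathbb{R}$, with reproducing kernel Hilbert space $\mathcal{H}(K_\ell)$ and norm $\|\cdot\|_\ell$. The worst-case error of a quadrature rule $Q$ is $e_{\alpha,\ell}(Q)=\sup_{\|f\|_\ell\le1}|I_\alpha(f)-Q(f)|$. For a finite set $X=\{x_1,\dots,x_n\}\subset\mathbb{R}$ of distinct points, $Q^{\mathrm{opt}}_{\alpha,\ell,X}(f)=\sum_{i=1}^n w_i f(x_i)$ is the rule on the points $X$ whose weights $(w_1,\dots,w_n)\in\mathbb{R}^n$ minimise the worst-case error $e_{\alpha,\ell}$ among all weights in $\mathbb{R}^n$. The power function is $P_{\ell,X}(x)=\sup_{\|f\|_\ell\le1}|f(x)-(s_{\ell,X}f)(x)|=\sup\{f(x) : \|f\|_\ell\le1,\ f(x_i)=0\text{ for all }x_i\in X\}$, where $s_{\ell,X}f$ is the element of minimal norm in $\mathcal{H}(K_\ell)$ that interpolates $f$ at the points of $X$. The fill-distance of a finite set $X$ on a bounded set $\Omega\subset\mathbb{R}$ is $h_{X,\Omega}=\sup_{x\in\Omega}\min_{x_i\in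 X\cap\Omega}|x-x_i|$, understood as $+\infty$ if $X\cap\Omega=\emptyset$ ($X$ need not be a subset of $\Omega$). $\|f\|_{L^1(\Omega)}=\int_\Omega|f(x)|\,dx$. *)

theory Defs
  imports "HOL-Analysis.Analysis"
begin

definition rkhs_norm :: "(('a \<Rightarrow> real) \<Rightarrow> ('a \<Rightarrow> real) \<Rightarrow> real) \<Rightarrow> ('a \<Rightarrow> real) \<Rightarrow> real" where
  "rkhs_norm ip f = sqrt (ip f f)"

(* H with inner product ip is a Hilbert space of functions that has K as its reproducing kernel.
   These axioms determine H, and ip on H, uniquely from K; nothing is required of ip outside H. *)
locale rkhs =
  fixes K :: "'a \<Rightarrow> 'a \<Rightarrow> real"
    and H :: "('a \<Rightarrow> real) set"
    and ip :: "('a \<Rightarrow> real) \<Rightarrow> ('a \<Rightarrow> real) \<Rightarrow> real"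
  assumes zero_mem: "(\<lambda>x. 0) \<in> H"
    and add_mem: "\<And>f g. f \<in> H \<Longrightarrow> g \<in> H \<Longrightarrow> (\<lambda>x. f x + g x) \<in> H"
    and scale_mem: "\<And>c f. f \<in> H \<Longrightarrow> (\<lambda>x. c * f x) \<in> H"
    and ip_sym: "\<And>f g. f \<in> H \<Longrightarrow> g \<in> H \<Longrightarrow> ip f g = ip g f"
    and ip_add: "\<And>f g h. f \<in> H \<Longrightarrow> g \<in> H \<Longrightarrow> h \<in> H \<Longrightarrow> ip (\<lambda>x. f x + g x) h = ip f h + ip g h"
    and ip_scale: "\<And>c f g. f \<in> H \<Longrightarrow> g \<in> H \<Longrightarrow> ip (\<lambda>x. c * f x) g = c * ip f g"
    and ip_nonneg: "\<And>f. f \<in> H \<Longrightarrow> 0 \<le> ip f f"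
    and ip_definite: "\<And>f. f \<in> H \<Longrightarrow> ip f f = 0 \<Longrightarrow> f = (\<lambda>x. 0)"
    and complete: "\<And>F :: nat \<Rightarrow> 'a \<Rightarrow> real. (\<And>n. F n \<in> H) \<Longrightarrow>
          (\<And>e. e > 0 \<Longrightarrow> \<exists>N. \<forall>m\<ge>N. \<forall>n\<ge>N. rkhs_norm ip (\<lambda>x. F m x - F n x) < e) \<Longrightarrow>
          \<exists>f\<in>H. (\<lambda>n. rkhs_norm ip (\<lambda>x. F n x - f x)) \<longlonglongrightarrow> 0"
    and kernel_mem: "\<And>x. (\<lambda>y. K y x) \<in> H"
    and reproducing: "\<And>f x. f \<in> H \<Longrightarrow> ip f (\<lambda>y. K y x) = f x"

definition gauss_kernel :: "real \<Rightarrow> real \<Rightarrow> real \<Rightarrow> real" where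
  "gauss_kernel l x y = exp (- (x - y)\<^sup>2 / (2 * l\<^sup>2))"

definition gauss_integral :: "real \<Rightarrow> (real \<Rightarrow> real) \<Rightarrow> real" where
  "gauss_integral \<alpha> f =
     1 / (sqrt (2 * pi) * \<alpha>) * (LINT x|lborel. f x * exp (- x\<^sup>2 / (2 * \<alpha>\<^sup>2)))"

(* The supremum is over a nonempty set, bounded above for the rules and kernels considered here. *)
definition worst_case_error ::
  "real \<Rightarrow> (real \<Rightarrow> real) set \<Rightarrow> ((real \<Rightarrow> real) \<Rightarrow> (real \<Rightarrow> real) \<Rightarrow> real)
    \<Rightarrow> ((real \<Rightarrow> real) \<Rightarrow> real) \<Rightarrow> real" where
  "worst_case_error \<alpha> H ip Q =
     (SUP f\<in>{f \<in> H. rkhs_norm ip f \<le> 1}. \<bar>gauss_integral \<alpha> f - Q f\<bar>)"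

(* Weights are indexed by the points themselves; values of w outside X are irrelevant. *)
definition quadrature :: "real set \<Rightarrow> (real \<Rightarrow> real) \<Rightarrow> (real \<Rightarrow> real) \<Rightarrow> real" where
  "quadrature X w f = (\<Sum>x\<in>X. w x * f x)"

definition opt_quadrature ::
  "real \<Rightarrow> (real \<Rightarrow> real) set \<Rightarrow> ((real \<Rightarrow> real) \<Rightarrow> (real \<Rightarrow> real) \<Rightarrow> real)
    \<Rightarrow> real set \<Rightarrow> (real \<Rightarrow> real) \<Rightarrow> real" where
  "opt_quadrature \<alpha> H ip X =
     quadrature X (ARG_MIN (\<lambda>w. worst_case_error \<alpha> H ip (quadrature X w)) w. True)"

definition interpolant ::
  "('a \<Rightarrow> real) set \<Rightarrow> (('a \<Rightarrow> real) \<Rightarrow> ('a \<Rightarrow> real) \<Rightarrow> real) \<Rightarrow> 'a set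
    \<Rightarrow> ('a \<Rightarrow> real) \<Rightarrow> 'a \<Rightarrow> real" where
  "interpolant H ip X f = (ARG_MIN (rkhs_norm ip) s. s \<in> H \<and> (\<forall>x\<in>X. s x = f x))"

definition power_function ::
  "('a \<Rightarrow> real) set \<Rightarrow> (('a \<Rightarrow> real) \<Rightarrow> ('a \<Rightarrow> real) \<Rightarrow> real) \<Rightarrow> 'a set \<Rightarrow> 'a \<Rightarrow> real" where
  "power_function H ip X x =
     (SUP f\<in>{f \<in> H. rkhs_norm ip f \<le> 1}. \<bar>f x - interpolant H ip X f x\<bar>)"

(* In ereal the infimum over the empty set is infinity, the convention for disjoint X and A. *)
definition fill_distance :: "real set \<Rightarrow> real set \<Rightarrow> ereal" where
  "fill_distance X A = (SUP x\<in>A. INF y\<in>X \<inter> A. ereal \<bar>x - y\<bar>)"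

definition L1_norm :: "real set \<Rightarrow> (real \<Rightarrow> real) \<Rightarrow> real" where
  "L1_norm A f = (LINT x:A|lborel. \<bar>f x\<bar>)"

definition shift_pos :: "nat \<Rightarrow> real set \<Rightarrow> real set" where
  "shift_pos q Y = (\<lambda>x. x + real q - 1) ` Y"

definition shift_neg :: "nat \<Rightarrow> real set \<Rightarrow> real set" where
  "shift_neg q Y = (\<lambda>x. x - real q) ` Y"

definition point_set :: "(nat \<Rightarrow> real set) \<Rightarrow> nat \<Rightarrow> real set" where
  "point_set Y k = (\<Union>m\<in>{1..k}. shift_pos m (Y (k - m + 1)) \<union> shift_neg m (Y (k - m + 1)))"

end

theory Submission imports Defs "HOL-Probability.Distributions" begin

section \<open>Optimal quadrature for the Gaussian kernel\<close>

text \<open>The optimal rule integrates the minimal-norm interpolant exactly, so its error at \<open>f\<close> is the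
  Gaussian integral of \<open>f - s f\<close> and the worst case is at most \<open>I(P)\<close> for the power function \<open>P\<close>.
  Outside \<open>[-g, g]\<close> one uses \<open>P \<le> 1\<close> and the Gaussian tail. On the unit intervals \<open>[j, j + 1]\<close> and
  \<open>[-j - 1, -j]\<close> with \<open>j < g\<close> the weight is at most its value at \<open>j\<close>, the point set is a translate of
  \<open>Y (k - j)\<close>, and \<open>nbar (k - j) \<ge> k - j \<ge> c / hbar\<close> makes the fill distance small enough for the
  assumed bound on the \<open>L\<^sup>1\<close> norm of \<open>P\<close>.\<close>

subsection \<open>Interpolation in a reproducing kernel Hilbert space\<close>

context rkhs
begin

section \<open>Inner-product algebra, Cauchy-Schwarz and pointwise bounds\<close>

lemma minus_mem: "f \<in> H \<Longrightarrow> (\<lambda>x. - f x) \<in> H"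
  using scale_mem[of f "-1"] by simp

lemma diff_mem: "f \<in> H \<Longrightarrow> g \<in> H \<Longrightarrow> (\<lambda>x. f x - g x) \<in> H"
  using add_mem[OF _ minus_mem, of f g] by simp

lemma sum_mem:
  assumes "finite A" "\<And>i. i \<in> A \<Longrightarrow> F i \<in> H"
  shows "(\<lambda>x. \<Sum>i\<in>A. a i * F i x) \<in> H"
  using assms by (induction A rule: finite_induct) (auto intro!: zero_mem add_mem scale_mem)

lemma ip_diff:
  assumes "f \<in> H" "g \<in> H" "h \<in> H"
  shows "ip (\<lambda>x. f x - g x) h = ip f h - ip g h"
  using ip_add[OF assms(1) minus_mem[OF assms(2)] assms(3)] ip_scale[OF assms(2,3), of "-1"]
  by simp

lemma ip_zero_right: "f \<in> H \<Longrightarrow> ip f (\<lambda>x. 0) = 0"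
  using ip_sym[OF zero_mem, of f] ip_scale[OF zero_mem, of f 0] by simp

lemma ip_add_right:
  "f \<in> H \<Longrightarrow> g \<in> H \<Longrightarrow> h \<in> H \<Longrightarrow> ip h (\<lambda>x. f x + g x) = ip h f + ip h g"
  by (simp add: ip_sym[of h] ip_add add_mem)

lemma ip_diff_right:
  "f \<in> H \<Longrightarrow> g \<in> H \<Longrightarrow> h \<in> H \<Longrightarrow> ip h (\<lambda>x. f x - g x) = ip h f - ip h g"
  by (simp add: ip_sym[of h] ip_diff diff_mem)

lemma ip_scale_right: "f \<in> H \<Longrightarrow> g \<in> H \<Longrightarrow> ip g (\<lambda>x. c * f x) = c * ip g f"
  by (simp add: ip_sym[of g] ip_scale scale_mem)

lemma ip_sum_right:
  assumes "finite A" "\<And>i. i \<in> A \<Longrightarrow> F i \<in> H" "g \<in> H"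
  shows "ip g (\<lambda>x. \<Sum>i\<in>A. a i * F i x) = (\<Sum>i\<in>A. a i * ip g (F i))"
  using assms(1,2)
proof (induction A rule: finite_induct)
  case empty
  then show ?case by (simp add: ip_zero_right assms(3))
next
  case (insert i A)
  have F: "F i \<in> H" "(\<lambda>x. \<Sum>j\<in>A. a j * F j x) \<in> H"
    using insert.prems insert.hyps by (auto intro: sum_mem)
  then show ?case
    using insert ip_add_right[OF scale_mem[OF F(1), of "a i"] F(2) assms(3)]
    by (simp add: ip_scale_right assms(3))
qed

lemma ip_diff_scale_self:
  assumes f: "f \<in> H" and g: "g \<in> H"
  shows "ip (\<lambda>x. f x - t * g x) (\<lambda>x. f x - t * g x) = ip f f - 2 * t * ip f g + t\<^sup>2 * ip g g"
proof -
  have m: "(\<lambda>x. t * g x) \<in> H" by (rule scale_mem[OF g])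
  show ?thesis
    using ip_diff[OF f m diff_mem[OF f m]] ip_diff_right[OF f m f] ip_diff_right[OF f m m]
      ip_scale[OF g f, of t] ip_scale[OF g m, of t] ip_scale_right[OF g f, of t]
      ip_scale_right[OF g g, of t] ip_sym[OF f g]
    by (simp add: power2_eq_square)
qed

lemma cauchy_schwarz:
  assumes f: "f \<in> H" and g: "g \<in> H"
  shows "\<bar>ip f g\<bar> \<le> rkhs_norm ip f * rkhs_norm ip g"
proof (cases "ip g g = 0")
  case True
  then have "g = (\<lambda>x. 0)" by (rule ip_definite[OF g])
  then show ?thesis using ip_zero_right[OF f] ip_zero_right[OF zero_mem] by (simp add: rkhs_norm_def)
next
  case False
  then have pos: "ip g g > 0" using ip_nonneg[OF g] by simp
  \<comment> \<open>The coefficient of the orthogonal projection of \<open>f\<close> onto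
    \<open>g\<close>; it minimises the quadratic in \<open>t\<close> given by
    \<open>ip_diff_scale_self\<close>.\<close>
  let ?t = "ip f g / ip g g"
  have "0 \<le> ip (\<lambda>x. f x - ?t * g x) (\<lambda>x. f x - ?t * g x)"
    by (intro ip_nonneg diff_mem f scale_mem g)
  also have "\<dots> = ip f f - 2 * ?t * ip f g + ?t\<^sup>2 * ip g g"
    by (rule ip_diff_scale_self[OF f g])
  also have "\<dots> = ip f f - (ip f g)\<^sup>2 / ip g g"
    using pos by (simp add: power2_eq_square)
  finally have "(ip f g)\<^sup>2 \<le> ip f f * ip g g" using pos by (simp add: field_simps)
  then have "sqrt ((ip f g)\<^sup>2) \<le> sqrt (ip f f * ip g g)" by (rule real_sqrt_le_mono)
  then show ?thesis by (simp add: rkhs_norm_def real_sqrt_mult)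
qed

lemma ip_kernel: "ip (\<lambda>z. K z x) (\<lambda>z. K z y) = K y x"
  by (rule reproducing[OF kernel_mem])

lemma abs_le_norm:
  assumes "f \<in> H"
  shows "\<bar>f x\<bar> \<le> rkhs_norm ip f * sqrt (K x x)"
  using cauchy_schwarz[OF assms kernel_mem, of x]
  by (simp add: reproducing assms rkhs_norm_def[of ip "\<lambda>z. K z x"] ip_kernel)

text \<open>By the reproducing property \<open>f x - f y\<close> is the inner product of
  \<open>f\<close> with a difference of kernel sections, and the radicand is the squared norm of
  that difference. This is the source of continuity, and hence of measurability, later on.\<close>

lemma abs_diff_le_norm:
  assumes "f \<in> H"
  shows "\<bar>f x - f y\<bar> \<le> rkhs_norm ip f * sqrt (K x x - K x y - K y x + K y y)"
proof -
  let ?d = "\<lambda>z. K z x - K z y"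
  have d: "?d \<in> H" by (intro diff_mem kernel_mem)
  have "ip f ?d = f x - f y"
    using ip_diff_right[OF kernel_mem kernel_mem assms] by (simp add: reproducing assms)
  moreover have "ip ?d ?d = K x x - K x y - K y x + K y y"
    using ip_diff_right[OF kernel_mem kernel_mem d, of x y] by (simp add: reproducing d)
  ultimately show ?thesis
    using cauchy_schwarz[OF assms d] by (simp add: rkhs_norm_def[of ip ?d])
qed

text \<open>Cardinal functions are built one point at a time. If the kernel section of the new point
  already lies in the span of the old ones, its cardinal function is zero, so strict positive
  definiteness of the kernel is not needed.\<close>

lemma exists_cardinal_functions:
  assumes "finite X"
  shows "\<exists>u. (\<forall>x\<in>X. u x \<in> H) \<and> (\<forall>f\<in>H. \<forall>y\<in>X. (\<Sum>x\<in>X. f x * u x y) = f y)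
    \<and> (\<forall>g\<in>H. (\<forall>y\<in>X. g y = 0) \<longrightarrow> (\<forall>x\<in>X. ip g (u x) = 0))"
  using assms
proof (induction X rule: finite_induct)
  case empty
  then show ?case by auto
next
  case (insert z X)
  from insert.IH obtain u where cardinal:
      "(\<forall>x\<in>X. u x \<in> H) \<and> (\<forall>f\<in>H. \<forall>y\<in>X. (\<Sum>x\<in>X. f x * u x y) = f y)
        \<and> (\<forall>g\<in>H. (\<forall>y\<in>X. g y = 0) \<longrightarrow> (\<forall>x\<in>X. ip g (u x) = 0))" ..
  then have u: "\<And>x. x \<in> X \<Longrightarrow> u x \<in> H"
    and interp: "\<And>f y. f \<in> H \<Longrightarrow> y \<in> X \<Longrightarrow> (\<Sum>x\<in>X. f x * u x y) = f y"
    and orth: "\<And>g x. g \<in> H \<Longrightarrow> (\<And>y. y \<in> X \<Longrightarrow> g y = 0) \<Longrightarrow> x \<in> X \<Longrightarrow> ip g (u x) = 0"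
    by simp_all
  define s where "s f = (\<lambda>y. \<Sum>x\<in>X. f x * u x y)" for f :: "'a \<Rightarrow> real"
  have sH: "s f \<in> H" for f unfolding s_def by (intro sum_mem insert.hyps u)
  have s_eq: "f \<in> H \<Longrightarrow> y \<in> X \<Longrightarrow> s f y = f y" for f y using interp by (simp add: s_def)
  have s_orth: "ip g (s f) = 0" if "g \<in> H" "\<And>y. y \<in> X \<Longrightarrow> g y = 0" for f g
    unfolding s_def using that by (subst ip_sum_right) (auto simp: u orth insert.hyps)
  define kz where "kz = (\<lambda>y. K y z)"
  \<comment> \<open>The component of the new kernel section orthogonal to the old cardinal
    functions. It vanishes on \<open>X\<close> and represents evaluation at \<open>z\<close> on the
    functions vanishing on \<open>X\<close>.\<close>
  define r where "r = (\<lambda>y. kz y - s kz y)"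
  have kz: "kz \<in> H" unfolding kz_def by (rule kernel_mem)
  have r: "r \<in> H" unfolding r_def by (intro diff_mem kz sH)
  have r0: "r y = 0" if "y \<in> X" for y using that kz s_eq by (simp add: r_def)
  have ip_r: "ip g r = g z" if "g \<in> H" "\<And>y. y \<in> X \<Longrightarrow> g y = 0" for g
    using ip_diff_right[OF kz sH that(1)] s_orth[OF that] reproducing[OF that(1), of z]
    by (simp add: r_def kz_def)
  \<comment> \<open>Normalising \<open>r\<close> gives value 1 at \<open>z\<close>; the old
    functions are corrected to vanish at \<open>z\<close>. If \<open>r z = 0\<close>, division by
    zero yields 0, so \<open>u' z\<close> is zero and the old functions stay unchanged.\<close>
  define u' where
    "u' x = (if x = z then (\<lambda>y. r y / r z) else (\<lambda>y. u x y - u x z * (r y / r z)))" for x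
  have nz: "x \<noteq> z" if "x \<in> X" for x using that insert.hyps by auto
  have rz: "(\<lambda>y. r y / r z) \<in> H" using scale_mem[OF r, of "1 / r z"] by simp
  have u'H: "u' x \<in> H" if "x \<in> insert z X" for x
    using that nz scale_mem[OF rz, of "u x z"] by (auto simp: u'_def intro!: rz diff_mem u)
  have s': "(\<Sum>x\<in>insert z X. f x * u' x y) = s f y + (f z - s f z) * (r y / r z)" for f y
  proof -
    have "(\<Sum>x\<in>X. f x * u' x y) = (\<Sum>x\<in>X. f x * (u x y - u x z * (r y / r z)))"
      using nz by (intro sum.cong) (auto simp: u'_def)
    also have "\<dots> = s f y - s f z * (r y / r z)"
      unfolding s_def right_diff_distrib sum_subtractf sum_distrib_right mult.assoc ..
    finally show ?thesis using insert.hyps by (simp add: u'_def left_diff_distrib diff_divide_distrib)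
  qed
  \<comment> \<open>Since \<open>ip r r = r z\<close>, the case \<open>r z = 0\<close> forces
    \<open>r\<close> to vanish. Pairing \<open>r\<close> with \<open>f - s f\<close>, which is zero
    on \<open>X\<close>, then shows that \<open>s f\<close> already matches \<open>f\<close> at
    \<open>z\<close>.\<close>
  have degenerate: "f z = s f z" if "f \<in> H" "r z = 0" for f
  proof -
    have "r = (\<lambda>x. 0)" using ip_definite[OF r] ip_r[OF r r0] that by simp
    moreover have "ip (\<lambda>y. f y - s f y) r = f z - s f z"
      by (rule ip_r) (auto intro: diff_mem that sH simp: s_eq that)
    ultimately show ?thesis using ip_zero_right[OF diff_mem[OF that(1) sH]] by simp
  qed
  have interp': "(\<Sum>x\<in>insert z X. f x * u' x y) = f y" if "f \<in> H" "y \<in> insert z X" for f y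
    unfolding s' using that degenerate[OF that(1)] s_eq[OF that(1)] r0 by (cases "y = z") auto
  have orth': "ip g (u' x) = 0" if g: "g \<in> H" "\<And>y. y \<in> insert z X \<Longrightarrow> g y = 0"
    and x: "x \<in> insert z X" for g x
  proof -
    have "ip g (\<lambda>y. r y / r z) = 0"
      using ip_scale_right[OF r g(1), of "1 / r z"] ip_r g by simp
    then show ?thesis
      using x nz g orth[OF g(1)] ip_diff_right[OF u scale_mem[OF rz] g(1), of x "u x z"]
        ip_scale_right[OF rz g(1)]
      by (auto simp: u'_def)
  qed
  show ?case
    by (intro exI[of _ u'] conjI ballI impI) (use u'H interp' orth' in \<open>blast+\<close>)
qed

lemma pythagoras:
  assumes "f \<in> H" "g \<in> H" "ip f g = 0"
  shows "ip (\<lambda>x. f x + g x) (\<lambda>x. f x + g x) = ip f f + ip g g"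
  using assms ip_add[OF assms(1,2) add_mem[OF assms(1,2)]] ip_add_right[OF assms(1,2)]
    ip_sym[OF assms(1,2)] by simp

text \<open>A competitor differs from \<open>s\<close> by a function vanishing on \<open>X\<close>,
  hence orthogonal to \<open>s\<close>. Pythagoras gives minimality and uniqueness at once;
  uniqueness identifies the element picked by \<open>ARG_MIN\<close>.\<close>

lemma interpolant_eq:
  assumes s: "s \<in> H" "\<And>y. y \<in> X \<Longrightarrow> s y = f y"
    and orth: "\<And>g. g \<in> H \<Longrightarrow> (\<And>y. y \<in> X \<Longrightarrow> g y = 0) \<Longrightarrow> ip g s = 0"
  shows "interpolant H ip X f = s"
proof -
  let ?P = "\<lambda>t. t \<in> H \<and> (\<forall>x\<in>X. t x = f x)"
  let ?t = "interpolant H ip X f"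
  have pyth: "ip t t = ip (\<lambda>y. t y - s y) (\<lambda>y. t y - s y) + ip s s" if "?P t" for t
    using pythagoras[OF diff_mem[of t s] s(1) orth[OF diff_mem[of t s]]] that s by simp
  have min: "rkhs_norm ip s \<le> rkhs_norm ip t" if "?P t" for t
    using pyth[OF that] ip_nonneg[OF diff_mem[of t s]] that s(1) by (simp add: rkhs_norm_def)
  have "?P s" using s by simp
  have "?P ?t \<and> rkhs_norm ip ?t \<le> rkhs_norm ip s"
    unfolding interpolant_def
    by (rule arg_minI[of ?P s "rkhs_norm ip"]) (use \<open>?P s\<close> min in \<open>auto simp: not_less\<close>)
  then have t: "?P ?t" "ip ?t ?t \<le> ip s s" by (auto simp: rkhs_norm_def)
  then have "ip (\<lambda>y. ?t y - s y) (\<lambda>y. ?t y - s y) = 0"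
    using pyth[OF t(1)] ip_nonneg[OF diff_mem[of ?t s]] s(1) by force
  then have "(\<lambda>y. ?t y - s y) = (\<lambda>x. 0)" using ip_definite diff_mem t(1) s(1) by blast
  then show ?thesis by (auto simp: fun_eq_iff)
qed

text \<open>The residual vanishes on \<open>X\<close>, so it is orthogonal to the interpolant and
  has no larger norm than \<open>f\<close>. The cardinal form shows that integrating the interpolant
  is a quadrature rule with nodes in \<open>X\<close>.\<close>

lemma interpolation:
  assumes "finite X"
  obtains u where "\<And>x. x \<in> X \<Longrightarrow> u x \<in> H"
    and "\<And>f. f \<in> H \<Longrightarrow> interpolant H ip X f = (\<lambda>y. \<Sum>x\<in>X. f x * u x y)"
    and "\<And>f x. f \<in> H \<Longrightarrow> x \<in> X \<Longrightarrow> interpolant H ip X f x = f x"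
    and "\<And>f. f \<in> H \<Longrightarrow> (\<lambda>y. f y - interpolant H ip X f y) \<in> H"
    and "\<And>f. f \<in> H \<Longrightarrow> rkhs_norm ip (\<lambda>y. f y - interpolant H ip X f y) \<le> rkhs_norm ip f"
proof -
  from exists_cardinal_functions[OF assms] obtain u where cardinal:
      "(\<forall>x\<in>X. u x \<in> H) \<and> (\<forall>f\<in>H. \<forall>y\<in>X. (\<Sum>x\<in>X. f x * u x y) = f y)
        \<and> (\<forall>g\<in>H. (\<forall>y\<in>X. g y = 0) \<longrightarrow> (\<forall>x\<in>X. ip g (u x) = 0))" ..
  then have u: "\<And>x. x \<in> X \<Longrightarrow> u x \<in> H"
    and interp: "\<And>f y. f \<in> H \<Longrightarrow> y \<in> X \<Longrightarrow> (\<Sum>x\<in>X. f x * u x y) = f y"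
    and orth: "\<And>g x. g \<in> H \<Longrightarrow> (\<And>y. y \<in> X \<Longrightarrow> g y = 0) \<Longrightarrow> x \<in> X \<Longrightarrow> ip g (u x) = 0"
    by simp_all
  define s where "s f = (\<lambda>y. \<Sum>x\<in>X. f x * u x y)" for f :: "'a \<Rightarrow> real"
  have sH: "s f \<in> H" for f unfolding s_def by (intro sum_mem assms u)
  have s_eq: "s f y = f y" if "f \<in> H" "y \<in> X" for f y using interp that by (simp add: s_def)
  have s_orth: "ip g (s f) = 0" if "g \<in> H" "\<And>y. y \<in> X \<Longrightarrow> g y = 0" for f g
    unfolding s_def using that by (subst ip_sum_right) (auto simp: u orth assms)
  have i: "interpolant H ip X f = s f" if "f \<in> H" for f
    by (rule interpolant_eq) (use that sH s_eq s_orth in auto)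
  have "rkhs_norm ip (\<lambda>y. f y - s f y) \<le> rkhs_norm ip f" if f: "f \<in> H" for f
  proof -
    have "ip (\<lambda>y. f y - s f y) (s f) = 0"
      by (rule s_orth) (auto intro: diff_mem f sH simp: s_eq f)
    from pythagoras[OF diff_mem[OF f sH] sH this] show ?thesis
      using ip_nonneg[OF sH] by (simp add: rkhs_norm_def)
  qed
  then show ?thesis
    using that[of u] u i s_eq diff_mem[OF _ sH] by (simp add: s_def)
qed

end

subsection \<open>Worst-case error and the power function\<close>

text \<open>Makes the total mass one and the integrability of the normal density available.\<close>

lemma gauss_integral_eq:
  assumes "\<alpha> > 0"
  shows "gauss_integral \<alpha> f = (LINT x|lborel. f x * normal_density 0 \<alpha> x)"
proof -
  have "(LINT x|lborel. f x * normal_density 0 \<alpha> x)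
      = (LINT x|lborel. (1 / (sqrt (2 * pi) * \<alpha>)) * (f x * exp (- x\<^sup>2 / (2 * \<alpha>\<^sup>2))))"
    using assms by (intro Bochner_Integration.integral_cong)
      (auto simp: normal_density_def real_sqrt_mult)
  then show ?thesis by (simp add: gauss_integral_def)
qed

lemma integrable_bounded_times_normal_density:
  assumes "\<alpha> > 0" "f \<in> borel_measurable borel" "\<And>x. \<bar>f x\<bar> \<le> B"
  shows "integrable lborel (\<lambda>x. f x * normal_density 0 \<alpha> x)"
proof (rule Bochner_Integration.integrable_bound)
  show "integrable lborel (\<lambda>x. B * normal_density 0 \<alpha> x)"
    using assms(1) by (intro integrable_mult_right integrable_normal_density)
  show "(\<lambda>x. f x * normal_density 0 \<alpha> x) \<in> borel_measurable lborel"
    using assms(2) by simp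
  show "AE x in lborel. norm (f x * normal_density 0 \<alpha> x) \<le> norm (B * normal_density 0 \<alpha> x)"
    by (intro AE_I2) (auto simp: abs_mult intro!: mult_right_mono order_trans[OF assms(3)])
qed

locale gauss_rkhs = rkhs "gauss_kernel l" H ip
  for l :: real and H :: "(real \<Rightarrow> real) set" and ip :: "(real \<Rightarrow> real) \<Rightarrow> (real \<Rightarrow> real) \<Rightarrow> real"
begin

lemma gauss_kernel_self: "gauss_kernel l x x = 1"
  by (simp add: gauss_kernel_def)

lemma gauss_kernel_commute: "gauss_kernel l x y = gauss_kernel l y x"
  by (simp add: gauss_kernel_def power2_commute)

lemma abs_le_rkhs_norm:
  assumes "f \<in> H"
  shows "\<bar>f x\<bar> \<le> rkhs_norm ip f"
  using abs_le_norm[OF assms, of x] by (simp add: gauss_kernel_def)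

lemma abs_diff_le_rkhs_norm:
  assumes "f \<in> H"
  shows "\<bar>f x - f y\<bar> \<le> rkhs_norm ip f * sqrt (2 - 2 * gauss_kernel l x y)"
  using abs_diff_le_norm[OF assms, of x y]
  by (simp add: gauss_kernel_self gauss_kernel_commute[of y x])

text \<open>The kernel tends to 1 at the diagonal, so the modulus tends to 0. The function is
  arbitrary because the power function is treated in the same way as members of
  \<open>H\<close>.\<close>

lemma continuous_on_of_modulus:
  fixes f :: "real \<Rightarrow> real"
  assumes "\<And>x y. \<bar>f x - f y\<bar> \<le> M * sqrt (2 - 2 * gauss_kernel l x y)"
  shows "continuous_on UNIV f"
  unfolding continuous_on_eq_continuous_at[OF open_UNIV]
proof
  fix y
  have "((\<lambda>x. M * sqrt (2 - 2 * gauss_kernel l x y)) \<longlongrightarrow> M * sqrt (2 - 2 * gauss_kernel l y y)) (at y)"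
    unfolding gauss_kernel_def divide_inverse by (intro tendsto_intros)
  then have lim: "((\<lambda>x. M * sqrt (2 - 2 * gauss_kernel l x y)) \<longlongrightarrow> 0) (at y)"
    by (simp add: gauss_kernel_def)
  have "((\<lambda>x. f x - f y) \<longlongrightarrow> 0) (at y)"
    by (rule Lim_null_comparison[OF _ lim]) (use assms in auto)
  then show "isCont f y" by (simp add: isCont_def LIM_zero_iff)
qed

lemma continuous_on_mem:
  assumes "f \<in> H"
  shows "continuous_on UNIV f"
  by (rule continuous_on_of_modulus[OF abs_diff_le_rkhs_norm[OF assms]])

lemma integrable_mem:
  assumes "\<alpha> > 0" "f \<in> H"
  shows "integrable lborel (\<lambda>x. f x * normal_density 0 \<alpha> x)"
  using integrable_bounded_times_normal_density[OF assms(1)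
      borel_measurable_continuous_onI[OF continuous_on_mem[OF assms(2)]]]
    abs_le_rkhs_norm[OF assms(2)] by blast

lemma abs_gauss_integral_le:
  assumes "\<alpha> > 0" "f \<in> H"
  shows "\<bar>gauss_integral \<alpha> f\<bar> \<le> rkhs_norm ip f"
proof -
  have "\<bar>LINT x|lborel. f x * normal_density 0 \<alpha> x\<bar>
      \<le> (LINT x|lborel. \<bar>f x * normal_density 0 \<alpha> x\<bar>)"
    using integral_norm_bound[of lborel "\<lambda>x. f x * normal_density 0 \<alpha> x"] by simp
  also have "\<dots> \<le> (LINT x|lborel. rkhs_norm ip f * normal_density 0 \<alpha> x)"
    using assms abs_le_rkhs_norm[OF assms(2)]
    by (intro integral_mono integrable_abs integrable_mem integrable_mult_right
          integrable_normal_density) (auto simp: abs_mult intro!: mult_right_mono)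
  also have "\<dots> = rkhs_norm ip f"
    using assms(1) by simp
  finally show ?thesis using assms(1) by (simp add: gauss_integral_eq)
qed

section \<open>Interpolation residuals and the power function of a fixed finite set\<close>

context
  fixes X :: "real set"
  assumes finite: "finite X"
begin

abbreviation residual :: "(real \<Rightarrow> real) \<Rightarrow> real \<Rightarrow> real" where
  "residual f \<equiv> \<lambda>y. f y - interpolant H ip X f y"

lemma residual_mem: "f \<in> H \<Longrightarrow> residual f \<in> H"
  using interpolation[OF finite] by metis

lemma rkhs_norm_residual_le: "f \<in> H \<Longrightarrow> rkhs_norm ip (residual f) \<le> rkhs_norm ip f"
  using interpolation[OF finite] by metis

lemma abs_residual_le_1:
  assumes "f \<in> H" "rkhs_norm ip f \<le> 1"
  shows "\<bar>residual f x\<bar> \<le> 1"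
  using abs_le_rkhs_norm[OF residual_mem[OF assms(1)], of x]
    rkhs_norm_residual_le[OF assms(1)] assms(2) by linarith

lemma abs_residual_le_power_function:
  assumes "f \<in> H" "rkhs_norm ip f \<le> 1"
  shows "\<bar>residual f x\<bar> \<le> power_function H ip X x"
  unfolding power_function_def
  by (rule cSUP_upper) (use assms in \<open>auto intro!: bdd_aboveI2 abs_residual_le_1\<close>)

lemma power_function_least:
  assumes "\<And>f. f \<in> H \<Longrightarrow> rkhs_norm ip f \<le> 1 \<Longrightarrow> \<bar>residual f x\<bar> \<le> B"
  shows "power_function H ip X x \<le> B"
proof -
  have "rkhs_norm ip (\<lambda>x. 0) = 0" by (simp add: rkhs_norm_def ip_zero_right zero_mem)
  then have "{f \<in> H. rkhs_norm ip f \<le> 1} \<noteq> {}" using zero_mem by force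
  then show ?thesis unfolding power_function_def by (rule cSUP_least) (use assms in auto)
qed

lemma power_function_le_1: "power_function H ip X x \<le> 1"
  by (intro power_function_least abs_residual_le_1)

lemma power_function_nonneg: "0 \<le> power_function H ip X x"
  by (rule order_trans[OF abs_ge_zero abs_residual_le_power_function[OF zero_mem]])
     (simp add: rkhs_norm_def ip_zero_right zero_mem)

text \<open>Residuals of the unit ball have norm at most 1 and so share one modulus of continuity,
  which passes to their supremum.\<close>

lemma continuous_on_power_function: "continuous_on UNIV (power_function H ip X)"
proof (rule continuous_on_of_modulus[where M = 1])
  fix x y
  have le: "power_function H ip X x \<le> power_function H ip X y + sqrt (2 - 2 * gauss_kernel l x y)" for x y
  proof (rule power_function_least)
    fix f assume f: "f \<in> H" "rkhs_norm ip f \<le> 1"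
    have "0 \<le> sqrt (2 - 2 * gauss_kernel l x y)" by (simp add: gauss_kernel_def)
    then have "rkhs_norm ip (residual f) * sqrt (2 - 2 * gauss_kernel l x y)
        \<le> 1 * sqrt (2 - 2 * gauss_kernel l x y)"
      using rkhs_norm_residual_le[OF f(1)] f(2) by (intro mult_right_mono) auto
    then show "\<bar>residual f x\<bar> \<le> power_function H ip X y + sqrt (2 - 2 * gauss_kernel l x y)"
      using abs_diff_le_rkhs_norm[OF residual_mem[OF f(1)], of x y]
        abs_residual_le_power_function[OF f, of y] by linarith
  qed
  show "\<bar>power_function H ip X x - power_function H ip X y\<bar>
      \<le> 1 * sqrt (2 - 2 * gauss_kernel l x y)"
    using le[of x y] le[of y x] by (simp add: abs_le_iff gauss_kernel_commute[of y x])
qed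

lemma borel_measurable_power_function [measurable]: "power_function H ip X \<in> borel_measurable borel"
  by (rule borel_measurable_continuous_onI[OF continuous_on_power_function])

lemma abs_gauss_integral_residual_le:
  assumes "\<alpha> > 0" "f \<in> H" "rkhs_norm ip f \<le> 1"
  shows "\<bar>gauss_integral \<alpha> (residual f)\<bar> \<le> gauss_integral \<alpha> (power_function H ip X)"
proof -
  have "\<bar>LINT x|lborel. residual f x * normal_density 0 \<alpha> x\<bar>
      \<le> (LINT x|lborel. \<bar>residual f x * normal_density 0 \<alpha> x\<bar>)"
    using integral_norm_bound[of lborel "\<lambda>x. residual f x * normal_density 0 \<alpha> x"] by simp
  also have "\<dots> \<le> (LINT x|lborel. power_function H ip X x * normal_density 0 \<alpha> x)"
  proof (rule integral_mono)
    show "integrable lborel (\<lambda>x. \<bar>residual f x * normal_density 0 \<alpha> x\<bar>)"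
      by (intro integrable_abs integrable_mem residual_mem assms)
  next
    show "integrable lborel (\<lambda>x. power_function H ip X x * normal_density 0 \<alpha> x)"
      using power_function_le_1 power_function_nonneg assms(1)
      by (intro integrable_bounded_times_normal_density[where B = 1]) auto
  next
    fix x :: real
    show "\<bar>residual f x * normal_density 0 \<alpha> x\<bar> \<le> power_function H ip X x * normal_density 0 \<alpha> x"
      using abs_residual_le_power_function[OF assms(2,3), of x]
      by (simp add: abs_mult mult_right_mono)
  qed
  finally show ?thesis using assms(1) by (simp add: gauss_integral_eq)
qed

text \<open>The weights \<open>I(u\<^sub>x)\<close> are optimal: their error at \<open>f\<close> is the error of any other rule at the
  residual of \<open>f\<close>, on which all rules with nodes in \<open>X\<close> vanish.\<close>

lemma worst_case_error_opt_quadrature_le: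
  assumes "\<alpha> > 0"
  shows "worst_case_error \<alpha> H ip (opt_quadrature \<alpha> H ip X)
    \<le> gauss_integral \<alpha> (power_function H ip X)"
proof -
  obtain u where u: "\<And>x. x \<in> X \<Longrightarrow> u x \<in> H"
    and s: "\<And>f. f \<in> H \<Longrightarrow> interpolant H ip X f = (\<lambda>y. \<Sum>x\<in>X. f x * u x y)"
    and s_eq: "\<And>f x. f \<in> H \<Longrightarrow> x \<in> X \<Longrightarrow> interpolant H ip X f x = f x"
    using interpolation[OF finite] by metis
  let ?e = "\<lambda>w. worst_case_error \<alpha> H ip (quadrature X w)"
  define v where "v x = gauss_integral \<alpha> (u x)" for x
  have err: "gauss_integral \<alpha> f - quadrature X v f = gauss_integral \<alpha> (residual f)"
    if f: "f \<in> H" for f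
  proof -
    have "(LINT x|lborel. (\<Sum>y\<in>X. f y * u y x) * normal_density 0 \<alpha> x)
        = (LINT x|lborel. (\<Sum>y\<in>X. f y * (u y x * normal_density 0 \<alpha> x)))"
      by (simp add: sum_distrib_right mult.assoc)
    also have "\<dots> = (\<Sum>y\<in>X. LINT x|lborel. f y * (u y x * normal_density 0 \<alpha> x))"
      by (intro Bochner_Integration.integral_sum integrable_mult_right integrable_mem assms u)
    also have "\<dots> = quadrature X v f"
      unfolding quadrature_def v_def gauss_integral_eq[OF assms] by (simp add: mult.commute)
    finally have q: "quadrature X v f = (LINT x|lborel. interpolant H ip X f x * normal_density 0 \<alpha> x)"
      by (simp add: s[OF f])
    have "integrable lborel (\<lambda>x. interpolant H ip X f x * normal_density 0 \<alpha> x)"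
      using integrable_mem[OF assms diff_mem[OF f residual_mem[OF f]]] by simp
    then show ?thesis
      unfolding q gauss_integral_eq[OF assms] left_diff_distrib
      using integrable_mem[OF assms f] by simp
  qed
  have ne: "{f \<in> H. rkhs_norm ip f \<le> 1} \<noteq> {}"
    using zero_mem by (force simp: rkhs_norm_def ip_zero_right[OF zero_mem])
  have upper: "\<bar>gauss_integral \<alpha> f - quadrature X w f\<bar> \<le> ?e w"
    if "f \<in> H" "rkhs_norm ip f \<le> 1" for f w
    unfolding worst_case_error_def
  proof (rule cSUP_upper)
    \<comment> \<open>A real supremum dominates its elements only over a bounded set; on the unit
      ball both the integral and the point values are bounded by 1 in absolute value.\<close>
    show "bdd_above ((\<lambda>f. \<bar>gauss_integral \<alpha> f - quadrature X w f\<bar>) ` {f \<in> H. rkhs_norm ip f \<le> 1})"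
    proof (rule bdd_aboveI2)
      fix f assume "f \<in> {f \<in> H. rkhs_norm ip f \<le> 1}"
      then have f: "f \<in> H" "rkhs_norm ip f \<le> 1" by auto
      have "\<bar>f x\<bar> \<le> 1" for x using abs_le_rkhs_norm[OF f(1), of x] f(2) by linarith
      then have "\<bar>w x * f x\<bar> \<le> \<bar>w x\<bar> * 1" for x
        unfolding abs_mult by (intro mult_left_mono) auto
      then have "\<bar>quadrature X w f\<bar> \<le> (\<Sum>x\<in>X. \<bar>w x\<bar> * 1)"
        unfolding quadrature_def by (intro order_trans[OF sum_abs] sum_mono)
      then show "\<bar>gauss_integral \<alpha> f - quadrature X w f\<bar> \<le> 1 + (\<Sum>x\<in>X. \<bar>w x\<bar> * 1)"
        using abs_gauss_integral_le[OF assms f(1)] f(2) by linarith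
    qed
  qed (use that in auto)
  have min: "?e v \<le> ?e w" for w
    unfolding worst_case_error_def[of \<alpha> H ip "quadrature X v"]
  proof (rule cSUP_least[OF ne])
    fix f assume "f \<in> {f \<in> H. rkhs_norm ip f \<le> 1}"
    then have f: "f \<in> H" "rkhs_norm ip f \<le> 1" by auto
    have "quadrature X w (residual f) = 0"
      by (simp add: quadrature_def s_eq[OF f(1)])
    then show "\<bar>gauss_integral \<alpha> f - quadrature X v f\<bar> \<le> ?e w"
      using upper[OF residual_mem[OF f(1)], of w] rkhs_norm_residual_le[OF f(1)] f(2) err[OF f(1)]
      by simp
  qed
  \<comment> \<open>The chosen minimiser may differ from \<open>v\<close>; only the equality of the
    minimal errors is used.\<close>
  have "?e (ARG_MIN ?e w. True) = ?e v"
    by (rule arg_min_equality[where P = "\<lambda>_. True" and f = ?e and k = v]) (use min in auto)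
  also have "?e v \<le> gauss_integral \<alpha> (power_function H ip X)"
    unfolding worst_case_error_def
    by (rule cSUP_least[OF ne]) (use assms err abs_gauss_integral_residual_le in auto)
  finally show ?thesis by (simp add: opt_quadrature_def)
qed

end

end

subsection \<open>Splitting the Gaussian integral\<close>

text \<open>Expanding the square, the cross term \<open>2 * x * t\<close> is nonnegative, so
  \<open>(x + t)\<^sup>2\<close> is at least \<open>x\<^sup>2 + t\<^sup>2\<close>.\<close>

lemma normal_density_shift_le:
  assumes "\<alpha> > 0" "0 \<le> x * t"
  shows "normal_density 0 \<alpha> (x + t) \<le> exp (- t\<^sup>2 / (2 * \<alpha>\<^sup>2)) * normal_density 0 \<alpha> x"
proof -
  have "exp (- (x + t)\<^sup>2 / (2 * \<alpha>\<^sup>2)) \<le> exp (- t\<^sup>2 / (2 * \<alpha>\<^sup>2)) * exp (- x\<^sup>2 / (2 * \<alpha>\<^sup>2))"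
    using assms unfolding exp_add[symmetric] add_divide_distrib[symmetric] exp_le_cancel_iff
    by (intro divide_right_mono) (auto simp: power2_sum mult.commute)
  then have "1 / sqrt (2 * pi * \<alpha>\<^sup>2) * exp (- (x + t)\<^sup>2 / (2 * \<alpha>\<^sup>2))
      \<le> 1 / sqrt (2 * pi * \<alpha>\<^sup>2) * (exp (- t\<^sup>2 / (2 * \<alpha>\<^sup>2)) * exp (- x\<^sup>2 / (2 * \<alpha>\<^sup>2)))"
    by (intro mult_left_mono) auto
  then show ?thesis by (simp add: normal_density_def mult_ac)
qed

lemma integrable_indicator_normal_density:
  assumes "\<alpha> > 0" "A \<in> sets borel"
  shows "integrable lborel (\<lambda>x. indicat_real A x * normal_density 0 \<alpha> x)"
  using assms by (intro integrable_bounded_times_normal_density[where B = 1]) (auto simp: indicator_def)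

text \<open>Translating each tail to a half-line at the origin costs the exponential factor. The two
  half-lines together carry mass one, so no further constant appears. One is closed and the other
  open, which keeps them disjoint.\<close>

lemma normal_tail_le:
  fixes t :: real
  assumes "\<alpha> > 0" "t \<ge> 0"
  shows "(LINT x|lborel. indicat_real ({t..} \<union> {..<-t}) x * normal_density 0 \<alpha> x)
    \<le> exp (- t\<^sup>2 / (2 * \<alpha>\<^sup>2))"
proof -
  let ?n = "normal_density 0 \<alpha>" and ?E = "exp (- t\<^sup>2 / (2 * \<alpha>\<^sup>2))"
  note int = integrable_indicator_normal_density[OF assms(1)]
  have shift: "(LINT x|lborel. indicat_real A x * ?n x)
      \<le> ?E * (LINT x|lborel. indicat_real B x * ?n x)"
    if "A \<in> sets borel" "B \<in> sets borel"
      and AB: "\<And>x. indicat_real A (x + s) = indicat_real B x"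
      and s: "\<And>x. x \<in> B \<Longrightarrow> 0 \<le> x * s" "s\<^sup>2 = t\<^sup>2" for A B s
  proof -
    have eq: "(LINT x|lborel. indicat_real A x * ?n x) = (LINT x|lborel. indicat_real B x * ?n (x + s))"
      using lborel_integral_real_affine[of 1 "\<lambda>x. indicat_real A x * ?n x" s]
      by (simp add: AB add.commute[of s])
    have "integrable lborel (\<lambda>x. indicat_real A (s + 1 * x) * ?n (s + 1 * x))"
      by (intro lborel_integrable_real_affine int that) simp
    then have "integrable lborel (\<lambda>x. indicat_real B x * ?n (x + s))"
      by (simp add: AB add.commute[of s])
    then have "(LINT x|lborel. indicat_real B x * ?n (x + s)) \<le> (LINT x|lborel. ?E * (indicat_real B x * ?n x))"
    proof (rule integral_mono)
      show "integrable lborel (\<lambda>x. ?E * (indicat_real B x * ?n x))"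
        by (intro integrable_mult_right int that)
      show "indicat_real B x * ?n (x + s) \<le> ?E * (indicat_real B x * ?n x)" for x
        using normal_density_shift_le[OF assms(1) s(1)] by (cases "x \<in> B") (auto simp: s(2))
    qed
    then show ?thesis unfolding eq by simp
  qed
  have split: "(LINT x|lborel. indicat_real (A \<union> B) x * ?n x)
      = (LINT x|lborel. indicat_real A x * ?n x) + (LINT x|lborel. indicat_real B x * ?n x)"
    if "A \<in> sets borel" "B \<in> sets borel" "A \<inter> B = {}" for A B
  proof -
    have "(LINT x|lborel. indicat_real (A \<union> B) x * ?n x)
        = (LINT x|lborel. indicat_real A x * ?n x + indicat_real B x * ?n x)"
      using that(3) by (intro Bochner_Integration.integral_cong) (auto simp: indicator_def)
    then show ?thesis using int that by simp
  qed
  have "(LINT x|lborel. indicat_real ({t..} \<union> {..<-t}) x * ?n x)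
      = (LINT x|lborel. indicat_real {t..} x * ?n x) + (LINT x|lborel. indicat_real {..<-t} x * ?n x)"
    using assms by (intro split) auto
  also have "\<dots> \<le> ?E * (LINT x|lborel. indicat_real {0..} x * ?n x)
      + ?E * (LINT x|lborel. indicat_real {..<0} x * ?n x)"
    using assms by (intro add_mono shift[where s = t] shift[where s = "- t"])
      (auto simp: indicator_def mult_nonpos_nonneg)
  also have "\<dots> = ?E * (LINT x|lborel. indicat_real ({0..} \<union> {..<0}) x * ?n x)"
    by (subst split) (auto simp: distrib_left)
  also have "({0..} \<union> {..<0}) = (UNIV :: real set)" by auto
  finally show ?thesis using assms(1) by simp
qed

lemma unit_interval_cover:
  fixes x :: real
  assumes "- real g \<le> x" "x < real g"
  obtains j where "j < g" "x \<in> {real j..real j + 1} \<or> x \<in> {- real j - 1..- real j}"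
proof (cases "x \<ge> 0")
  case True
  then have "nat \<lfloor>x\<rfloor> < g" using assms by linarith
  moreover have "x \<in> {real (nat \<lfloor>x\<rfloor>)..real (nat \<lfloor>x\<rfloor>) + 1}" using True by simp
  ultimately show ?thesis using that by blast
next
  case False
  \<comment> \<open>Rounding \<open>- x\<close> up and subtracting one, instead of rounding down,
    keeps \<open>j < g\<close> at the endpoint \<open>x = - real g\<close>.\<close>
  define j where "j = nat (\<lceil>- x\<rceil> - 1)"
  have c: "\<lceil>- x\<rceil> \<ge> 1" "\<lceil>- x\<rceil> \<le> int g" using False assms by linarith+
  then have "j < g" and j: "real j = of_int \<lceil>- x\<rceil> - 1" unfolding j_def by linarith+
  moreover have "x \<in> {- real j - 1..- real j}" unfolding j by simp linarith
  ultimately show ?thesis using that by blast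
qed

lemma gauss_integral_split_le:
  fixes P :: "real \<Rightarrow> real" and B :: "nat \<Rightarrow> real"
  assumes \<alpha>: "\<alpha> > 0" and P [measurable]: "P \<in> borel_measurable borel"
    and P01: "\<And>x. 0 \<le> P x" "\<And>x. P x \<le> 1"
    and pos: "\<And>j. j < g \<Longrightarrow> L1_norm {real j..real j + 1} P \<le> B j"
    and neg: "\<And>j. j < g \<Longrightarrow> L1_norm {- real j - 1..- real j} P \<le> B j"
  shows "gauss_integral \<alpha> P \<le> exp (- (real g)\<^sup>2 / (2 * \<alpha>\<^sup>2))
    + sqrt 2 / (sqrt pi * \<alpha>) * (\<Sum>j<g. exp (- (real j)\<^sup>2 / (2 * \<alpha>\<^sup>2)) * B j)"
proof -
  let ?n = "normal_density 0 \<alpha>" and ?T = "{real g..} \<union> {..<- real g}"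
  \<comment> \<open>The density at \<open>j\<close>, its maximum over both mirror cells
    \<open>A j\<close> and \<open>A' j\<close>.\<close>
  define c where "c j = 1 / sqrt (2 * pi * \<alpha>\<^sup>2) * exp (- (real j)\<^sup>2 / (2 * \<alpha>\<^sup>2))" for j
  define A where "A j = {real j..real j + 1}" for j
  define A' where "A' j = {- real j - 1..- real j}" for j
  have c0: "c j \<ge> 0" for j by (simp add: c_def)
  have n_le: "?n x \<le> c j" if "\<bar>x\<bar> \<ge> real j" for j x
  proof -
    have "(real j)\<^sup>2 \<le> x\<^sup>2" using that by (metis abs_of_nat abs_le_square_iff)
    then show ?thesis unfolding normal_density_def c_def
      by (intro mult_left_mono) (auto intro!: divide_right_mono)
  qed
  have int: "integrable lborel (\<lambda>x. indicat_real {a..b} x * P x)" for a b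
  proof (rule Bochner_Integration.integrable_bound)
    show "integrable lborel (indicat_real {a..b})"
      by (intro integrable_real_indicator emeasure_compact_finite) auto
    show "AE x in lborel. norm (indicat_real {a..b} x * P x) \<le> norm (indicat_real {a..b} x)"
      using P01 by (intro AE_I2) (auto simp: indicator_def)
  qed simp
  have L1: "L1_norm {a..b} P = (LINT x|lborel. indicat_real {a..b} x * P x)" for a b
    using P01 by (simp add: L1_norm_def set_lebesgue_integral_def)
  \<comment> \<open>Closed cells overlap at endpoints, but all terms of the majorant are
    nonnegative, so one cell containing \<open>x\<close> suffices.\<close>
  have "(LINT x|lborel. P x * ?n x) \<le> (LINT x|lborel. indicat_real ?T x * ?n x
      + (\<Sum>j<g. c j * (indicat_real (A j) x * P x) + c j * (indicat_real (A' j) x * P x)))"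
  proof (rule integral_mono)
    show "integrable lborel (\<lambda>x. P x * ?n x)"
      using P01 by (intro integrable_bounded_times_normal_density[OF \<alpha> P, of 1]) auto
    show "integrable lborel (\<lambda>x. indicat_real ?T x * ?n x
      + (\<Sum>j<g. c j * (indicat_real (A j) x * P x) + c j * (indicat_real (A' j) x * P x)))"
      unfolding A_def A'_def
      by (intro Bochner_Integration.integrable_add Bochner_Integration.integrable_sum
            integrable_mult_right int integrable_indicator_normal_density[OF \<alpha>]) auto
    fix x :: real
    let ?F = "\<lambda>j. c j * (indicat_real (A j) x * P x) + c j * (indicat_real (A' j) x * P x)"
    have F0: "?F j \<ge> 0" for j using c0 P01 by (simp add: indicator_def)
    show "P x * ?n x \<le> indicat_real ?T x * ?n x + (\<Sum>j<g. ?F j)"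
    proof (cases "x \<in> ?T")
      case True
      have "P x * ?n x \<le> 1 * ?n x" using P01 by (intro mult_right_mono) auto
      then show ?thesis using True sum_nonneg[of "{..<g}" ?F] F0 by auto
    next
      case False
      then obtain j where j: "j < g" "x \<in> A j \<or> x \<in> A' j"
        using unit_interval_cover[of g x] by (auto simp: A_def A'_def)
      have "\<bar>x\<bar> \<ge> real j" using j(2) by (auto simp: A_def A'_def)
      then have "P x * ?n x \<le> P x * c j" using P01 n_le by (intro mult_left_mono) auto
      also have "\<dots> \<le> ?F j" using j(2) c0[of j] P01(1)[of x] by (auto simp: indicator_def mult.commute)
      also have "\<dots> \<le> (\<Sum>j<g. ?F j)" using j(1) F0 by (intro member_le_sum) auto
      finally show ?thesis using False by simp
    qed
  qed
  also have "\<dots> = (LINT x|lborel. indicat_real ?T x * ?n x)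
      + (\<Sum>j<g. c j * L1_norm (A j) P + c j * L1_norm (A' j) P)"
  proof -
    have "(LINT x|lborel. indicat_real ?T x * ?n x
        + (\<Sum>j<g. c j * (indicat_real (A j) x * P x) + c j * (indicat_real (A' j) x * P x)))
      = (LINT x|lborel. indicat_real ?T x * ?n x)
        + (LINT x|lborel. (\<Sum>j<g. c j * (indicat_real (A j) x * P x) + c j * (indicat_real (A' j) x * P x)))"
      unfolding A_def A'_def
      by (intro Bochner_Integration.integral_add Bochner_Integration.integrable_add
            Bochner_Integration.integrable_sum
            integrable_mult_right int integrable_indicator_normal_density[OF \<alpha>]) auto
    also have "(LINT x|lborel. (\<Sum>j<g. c j * (indicat_real (A j) x * P x) + c j * (indicat_real (A' j) x * P x)))
       = (\<Sum>j<g. LINT x|lborel. c j * (indicat_real (A j) x * P x) + c j * (indicat_real (A' j) x * P x))"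
      unfolding A_def A'_def
      by (intro Bochner_Integration.integral_sum Bochner_Integration.integrable_add
            integrable_mult_right int)
    also have "\<dots> = (\<Sum>j<g. c j * L1_norm (A j) P + c j * L1_norm (A' j) P)"
      unfolding A_def A'_def L1 using int by (intro sum.cong refl) simp
    finally show ?thesis .
  qed
  also have "\<dots> \<le> exp (- (real g)\<^sup>2 / (2 * \<alpha>\<^sup>2)) + (\<Sum>j<g. c j * B j + c j * B j)"
    using pos neg c0
    by (intro add_mono normal_tail_le \<alpha> sum_mono mult_left_mono) (auto simp: A_def A'_def)
  also have "(\<Sum>j<g. c j * B j + c j * B j)
      = sqrt 2 / (sqrt pi * \<alpha>) * (\<Sum>j<g. exp (- (real j)\<^sup>2 / (2 * \<alpha>\<^sup>2)) * B j)"
  proof -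
    \<comment> \<open>The two mirror cells double the normalising factor; this is where
      \<open>sqrt 2 / (sqrt pi * \<alpha>)\<close> comes from.\<close>
    have "1 / sqrt (2 * pi * \<alpha>\<^sup>2) + 1 / sqrt (2 * pi * \<alpha>\<^sup>2) = sqrt 2 / (sqrt pi * \<alpha>)"
      using \<alpha> by (simp add: real_sqrt_mult field_simps)
    then have "c j * B j + c j * B j
        = sqrt 2 / (sqrt pi * \<alpha>) * (exp (- (real j)\<^sup>2 / (2 * \<alpha>\<^sup>2)) * B j)" for j
      unfolding c_def by (metis distrib_right mult.assoc)
    then show ?thesis by (simp add: sum_distrib_left)
  qed
  finally show ?thesis unfolding gauss_integral_eq[OF \<alpha>] .
qed

subsection \<open>Fill distance and cardinality of the point set\<close>

text \<open>Points of the closed unit interval are limits of points of the open one, so passing to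
  the closure and translating keeps the bound up to an arbitrary \<open>e\<close>.\<close>

lemma fill_distance_translate_le:
  assumes Y: "Y \<subseteq> {0<..<1}" and X: "X \<inter> {a..a + 1} = (\<lambda>y. y + a) ` Y"
    and le: "fill_distance Y {0<..<1} \<le> ereal r"
  shows "fill_distance X {a..a + 1} \<le> ereal r"
  unfolding fill_distance_def
proof (rule SUP_least)
  fix x assume "x \<in> {a..a + 1}"
  then have t: "x - a \<in> {0..1}" by auto
  show "(INF y\<in>X \<inter> {a..a + 1}. ereal \<bar>x - y\<bar>) \<le> ereal r"
  proof (rule ereal_le_epsilon2)
    fix e :: real assume e: "0 < e"
    have "x - a \<in> closure {0<..<1}" using t by simp
    then obtain t' where t': "t' \<in> {0<..<1}" "dist t' (x - a) < e / 2"
      using e by (meson closure_approachable half_gt_zero)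
    have "Y \<inter> {0<..<1} = Y" using Y by auto
    then have "(INF y\<in>Y. ereal \<bar>t' - y\<bar>) \<le> fill_distance Y {0<..<1}"
      unfolding fill_distance_def using t'(1) by (intro SUP_upper2[of t']) auto
    also have "\<dots> < ereal (r + e / 2)"
      using e by (intro le_less_trans[OF le]) simp
    finally obtain y where y: "y \<in> Y" "\<bar>t' - y\<bar> < r + e / 2"
      by (auto simp: INF_less_iff)
    have "(INF y\<in>X \<inter> {a..a + 1}. ereal \<bar>x - y\<bar>) \<le> ereal \<bar>x - (y + a)\<bar>"
      using y(1) by (intro INF_lower) (simp add: X)
    also have "\<dots> \<le> ereal (r + e)" using t'(2) y(2) unfolding dist_real_def ereal_less_eq by argo
    finally show "(INF y\<in>X \<inter> {a..a + 1}. ereal \<bar>x - y\<bar>) \<le> ereal r + ereal e" by simp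
  qed
qed

text \<open>A finite set misses some point of the interval and stays a positive distance away from
  it. Positivity keeps \<open>ln h / h\<close> away from the default values at 0.\<close>

lemma fill_distance_pos:
  assumes "finite X" "a < b"
  shows "0 < fill_distance X {a..b}"
proof -
  obtain x where x: "x \<in> {a..b}" "x \<notin> X"
    using infinite_Icc[OF assms(2)] assms(1) by (meson finite_subset subsetI)
  obtain d where d: "d > 0" "\<And>y. y \<in> X \<Longrightarrow> y \<noteq> x \<Longrightarrow> d \<le> dist x y"
    using finite_set_avoid[OF assms(1), of x] by blast
  have "0 < ereal d" using d(1) by simp
  also have "ereal d \<le> (INF y\<in>X \<inter> {a..b}. ereal \<bar>x - y\<bar>)"
    using d(2) x(2) by (intro INF_greatest) (auto simp: dist_real_def)
  also have "\<dots> \<le> fill_distance X {a..b}"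
    unfolding fill_distance_def using x(1) by (intro SUP_upper)
  finally show ?thesis .
qed

section \<open>The point set cell by cell, and its cardinality\<close>

lemma mem_shift_pos:
  assumes "x \<in> shift_pos m Z" "Z \<subseteq> {0<..<1}"
  shows "real m - 1 < x" "x < real m"
  using assms by (auto simp: shift_pos_def)

lemma mem_shift_neg:
  assumes "x \<in> shift_neg m Z" "Z \<subseteq> {0<..<1}"
  shows "- real m < x" "x < 1 - real m"
  using assms by (auto simp: shift_neg_def)

context
  fixes Y :: "nat \<Rightarrow> real set" and k :: nat
  assumes Y: "\<And>m. m \<ge> 1 \<Longrightarrow> Y m \<subseteq> {0<..<1}" and fin: "\<And>m. m \<ge> 1 \<Longrightarrow> finite (Y m)"
begin

lemma finite_point_set: "finite (point_set Y k)"
  using fin by (auto simp: point_set_def shift_pos_def shift_neg_def)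

text \<open>The translates occupy disjoint open unit cells, and only the positive one with
  \<open>m = j + 1\<close> meets this interval, even at the endpoints. Its index is
  \<open>k - (j + 1) + 1 = k - j\<close>.\<close>

lemma point_set_Int_pos:
  assumes "j < k"
  shows "point_set Y k \<inter> {real j..real j + 1} = (\<lambda>y. y + real j) ` Y (k - j)"
proof
  show "point_set Y k \<inter> {real j..real j + 1} \<subseteq> (\<lambda>y. y + real j) ` Y (k - j)"
  proof
    fix x assume "x \<in> point_set Y k \<inter> {real j..real j + 1}"
    then obtain m where m: "1 \<le> m" "m \<le> k" and xj: "real j \<le> x" "x \<le> real j + 1"
      and x: "x \<in> shift_pos m (Y (k - m + 1)) \<or> x \<in> shift_neg m (Y (k - m + 1))"
      by (auto simp: point_set_def)
    from m have "1 \<le> real m" by simp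
    then have pos: "x \<in> shift_pos m (Y (k - m + 1))"
      using x mem_shift_neg[OF _ Y, of x m "k - m + 1"] xj by force
    have "real m - 1 < real j + 1" "real j < real m"
      using mem_shift_pos[OF pos Y] xj by auto
    then have "m = Suc j" by linarith
    then show "x \<in> (\<lambda>y. y + real j) ` Y (k - j)" using pos m by (auto simp: shift_pos_def Suc_diff_Suc)
  qed
  show "(\<lambda>y. y + real j) ` Y (k - j) \<subseteq> point_set Y k \<inter> {real j..real j + 1}"
  proof
    fix x assume x: "x \<in> (\<lambda>y. y + real j) ` Y (k - j)"
    then have "x \<in> shift_pos (j + 1) (Y (k - (j + 1) + 1))"
      using assms by (auto simp: shift_pos_def Suc_diff_Suc)
    moreover from this have "x \<in> {real j..real j + 1}"
      using mem_shift_pos[OF _ Y] by fastforce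
    ultimately show "x \<in> point_set Y k \<inter> {real j..real j + 1}"
      using assms unfolding point_set_def by (intro IntI UN_I[of "j + 1"]) auto
  qed
qed

text \<open>Mirror case: the only cell met is the negative one with \<open>m = j + 1\<close>, a
  translate by \<open>- (j + 1)\<close>.\<close>

lemma point_set_Int_neg:
  assumes "j < k"
  shows "point_set Y k \<inter> {- real j - 1..- real j} = (\<lambda>y. y + (- real j - 1)) ` Y (k - j)"
proof
  show "point_set Y k \<inter> {- real j - 1..- real j} \<subseteq> (\<lambda>y. y + (- real j - 1)) ` Y (k - j)"
  proof
    fix x assume "x \<in> point_set Y k \<inter> {- real j - 1..- real j}"
    then obtain m where m: "1 \<le> m" "m \<le> k" and xj: "- real j - 1 \<le> x" "x \<le> - real j"
      and x: "x \<in> shift_pos m (Y (k - m + 1)) \<or> x \<in> shift_neg m (Y (k - m + 1))"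
      by (auto simp: point_set_def)
    from m have "1 \<le> real m" by simp
    then have neg: "x \<in> shift_neg m (Y (k - m + 1))"
      using x mem_shift_pos[OF _ Y, of x m "k - m + 1"] xj by force
    have "- real m < - real j" "- real j - 1 < 1 - real m"
      using mem_shift_neg[OF neg Y] xj by auto
    then have "m = Suc j" by linarith
    then show "x \<in> (\<lambda>y. y + (- real j - 1)) ` Y (k - j)" using neg m by (auto simp: shift_neg_def Suc_diff_Suc)
  qed
  show "(\<lambda>y. y + (- real j - 1)) ` Y (k - j) \<subseteq> point_set Y k \<inter> {- real j - 1..- real j}"
  proof
    fix x assume x: "x \<in> (\<lambda>y. y + (- real j - 1)) ` Y (k - j)"
    then have "x \<in> shift_neg (j + 1) (Y (k - (j + 1) + 1))"
      using assms by (auto simp: shift_neg_def Suc_diff_Suc)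
    moreover from this have "x \<in> {- real j - 1..- real j}"
      using mem_shift_neg[OF _ Y] by fastforce
    ultimately show "x \<in> point_set Y k \<inter> {- real j - 1..- real j}"
      using assms unfolding point_set_def by (intro IntI UN_I[of "j + 1"]) auto
  qed
qed

lemma card_point_set: "card (point_set Y k) = 2 * (\<Sum>m=1..k. card (Y m))"
proof -
  define S where "S m = shift_pos m (Y (k - m + 1)) \<union> shift_neg m (Y (k - m + 1))" for m
  have S_cases: "(real m - 1 < x \<and> x < real m) \<or> (- real m < x \<and> x < 1 - real m)"
    if "x \<in> S m" for x m
    using that mem_shift_pos[OF _ Y, of x m "k - m + 1"] mem_shift_neg[OF _ Y, of x m "k - m + 1"]
    by (auto simp: S_def)
  have card_S: "card (S m) = 2 * card (Y (k - m + 1))" if "m \<ge> 1" for m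
  proof -
    have "card (S m) = card (shift_pos m (Y (k - m + 1))) + card (shift_neg m (Y (k - m + 1)))"
      unfolding S_def
    proof (rule card_Un_disjoint)
      have "False" if "x \<in> shift_pos m (Y (k - m + 1))" "x \<in> shift_neg m (Y (k - m + 1))" for x
        using mem_shift_pos[OF that(1) Y] mem_shift_neg[OF that(2) Y] \<open>m \<ge> 1\<close> by auto
      then show "shift_pos m (Y (k - m + 1)) \<inter> shift_neg m (Y (k - m + 1)) = {}" by blast
    qed (use fin in \<open>auto simp: shift_pos_def shift_neg_def\<close>)
    then show ?thesis
      by (simp add: shift_pos_def shift_neg_def card_image inj_on_def)
  qed
  have disj: "S m \<inter> S n = {}" if "m \<ge> 1" "n \<ge> 1" "m \<noteq> n" for m n
  proof -
    have False if "x \<in> S m" "x \<in> S n" for x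
    proof -
      have "real m \<ge> 1" "real n \<ge> 1" using \<open>m \<ge> 1\<close> \<open>n \<ge> 1\<close> by auto
      \<comment> \<open>A common point must lie on the same side in both cases, since positive and
        negative cells are separated by 0; so the indices differ by less than 1.\<close>
      then have "real m < real n + 1 \<and> real n < real m + 1"
        using S_cases[OF that(1)] S_cases[OF that(2)] by argo
      then show False using \<open>m \<noteq> n\<close> by linarith
    qed
    then show ?thesis by blast
  qed
  have "card (point_set Y k) = (\<Sum>m\<in>{1..k}. card (S m))"
    unfolding point_set_def S_def[symmetric]
    using fin disj by (intro card_UN_disjoint) (auto simp: S_def shift_pos_def shift_neg_def)
  also have "\<dots> = 2 * (\<Sum>m=1..k. card (Y (k - m + 1)))"
    using card_S by (simp add: sum_distrib_left)
  also have "(\<Sum>m=1..k. card (Y (k - m + 1))) = (\<Sum>m=1..k. card (Y m))"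
    by (rule sum.reindex_bij_witness[of _ "\<lambda>m. k - m + 1" "\<lambda>m. k - m + 1"]) auto
  finally show ?thesis .
qed

end

text \<open>The factor \<open>1/2\<close> in the rate absorbs \<open>ln c\<close>, which is at most \<open>ln n / 2\<close>.\<close>

lemma exp_fill_distance_le:
  fixes h c n C :: real
  assumes "0 < h" "h \<le> c / n" "c / n \<le> 1" "c\<^sup>2 \<le> n" "0 < c" "0 < n" "0 < C"
  shows "exp (C * ln h / h) \<le> exp (- (C / (2 * c) * n * ln n))"
proof -
  have r: "0 < c / n" using assms by simp
  have "ln (c / n) \<le> 0" using r assms(3) ln_le_zero_iff by blast
  \<comment> \<open>Monotonicity of \<open>ln h / h\<close> in two moves: raise the argument of
    \<open>ln\<close>, then the denominator, where the nonpositive numerator gives the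
    direction.\<close>
  have "ln h / h \<le> ln (c / n) / h"
    using assms r by (intro divide_right_mono) auto
  also have "\<dots> \<le> ln (c / n) / (c / n)"
    using \<open>ln (c / n) \<le> 0\<close> assms r by (intro divide_left_mono_neg) auto
  also have "\<dots> = n / c * (ln c - ln n)" using assms by (simp add: ln_div)
  also have "\<dots> \<le> n / c * (- ln n / 2)"
  proof (rule mult_left_mono)
    have "ln (c\<^sup>2) \<le> ln n" using assms by (subst ln_le_cancel_iff) auto
    then show "ln c - ln n \<le> - ln n / 2" using assms by (simp add: ln_realpow)
  qed (use assms in auto)
  finally have "C * (ln h / h) \<le> C * (n / c * (- ln n / 2))"
    using assms by (intro mult_left_mono) auto
  then show ?thesis by (simp add: field_simps)
qed

section \<open>Assembly of the error bound\<close>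

theorem proposition3p2:
  fixes \<alpha> l c C h0 :: real
    and H :: "(real \<Rightarrow> real) set"
    and ip :: "(real \<Rightarrow> real) \<Rightarrow> (real \<Rightarrow> real) \<Rightarrow> real"
    and nbar :: "nat \<Rightarrow> nat"
    and Y :: "nat \<Rightarrow> real set"
    and k :: nat
  assumes "\<alpha> > 0" and "l > 0"
    and "rkhs (gauss_kernel l) H ip"
    and "strict_mono_on {1..} nbar"
    and "\<And>m. m \<ge> 1 \<Longrightarrow> nbar m > 0"
    and "\<And>m. m \<ge> 1 \<Longrightarrow> Y m \<subseteq> {0<..<1} \<and> finite (Y m) \<and> card (Y m) = nbar m"
    and "c > 0"
    and "\<And>m. m \<ge> 1 \<Longrightarrow> fill_distance (Y m) {0<..<1} \<le> ereal (c / real (nbar m))"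
    and "C > 0" and "0 < h0" and "h0 \<le> 1"
    and "\<And>a X. finite X \<Longrightarrow> fill_distance X {a..a + 1} \<le> ereal h0 \<Longrightarrow>
           L1_norm {a..a + 1} (power_function H ip X)
             \<le> exp (C * ln (real_of_ereal (fill_distance X {a..a + 1}))
                      / real_of_ereal (fill_distance X {a..a + 1}))"
  shows "card (point_set Y k) = 2 * (\<Sum>m=1..k. nbar m) \<and>
    (let hbar = min h0 (1 / c);
         g = nat \<lfloor>real k + 1 - c / hbar\<rfloor>;
         C1 = sqrt 2 / (sqrt pi * \<alpha>);
         C2 = C / (2 * c)
     in real k \<ge> c / hbar \<longrightarrow>
        worst_case_error \<alpha> H ip (opt_quadrature \<alpha> H ip (point_set Y k))
          \<le> exp (- (real g)\<^sup>2 / (2 * \<alpha>\<^sup>2))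
            + C1 * (\<Sum>m=k - g + 1..k.
                exp (- ((real k - real m)\<^sup>2 / (2 * \<alpha>\<^sup>2)
                        + C2 * real (nbar m) * ln (real (nbar m))))))"
proof -
  interpret gauss_rkhs l H ip using assms(3) by (simp add: gauss_rkhs_def)
  have Y01: "Y m \<subseteq> {0<..<1}" and finY: "finite (Y m)" and cardY: "card (Y m) = nbar m"
    if "m \<ge> 1" for m
    using assms(6) that by auto
  define X where "X = point_set Y k"
  \<comment> \<open>The bound \<open>h0\<close> admits the assumed estimate for the power function;
    the bound \<open>1 / c\<close> yields \<open>c\<^sup>2 \<le> c / hbar\<close>, hence the factor
    1/2 in the rate.\<close>
  define hbar where "hbar = min h0 (1 / c)"
  define g where "g = nat \<lfloor>real k + 1 - c / hbar\<rfloor>"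
  let ?B = "\<lambda>n. exp (- (C / (2 * c) * real n * ln (real n)))"
  have card: "card X = 2 * (\<Sum>m=1..k. nbar m)"
    unfolding X_def using card_point_set[OF Y01 finY] cardY by simp
  have finX: "finite X" unfolding X_def by (rule finite_point_set[OF Y01 finY])
  have "worst_case_error \<alpha> H ip (opt_quadrature \<alpha> H ip X)
      \<le> exp (- (real g)\<^sup>2 / (2 * \<alpha>\<^sup>2)) + sqrt 2 / (sqrt pi * \<alpha>) * (\<Sum>m=k - g + 1..k.
          exp (- ((real k - real m)\<^sup>2 / (2 * \<alpha>\<^sup>2) + C / (2 * c) * real (nbar m) * ln (real (nbar m)))))"
    if k: "real k \<ge> c / hbar"
  proof -
    have hbar: "0 < hbar" "hbar \<le> h0" "hbar \<le> 1 / c" using assms by (auto simp: hbar_def)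
    have q: "0 < c / hbar" using hbar assms by simp
    \<comment> \<open>The floor is at least 1 because \<open>k \<ge> c / hbar\<close>, so
      \<open>nat\<close> truncates nothing; it is at most \<open>k\<close> because
      \<open>c / hbar > 0\<close>.\<close>
    have g: "g \<le> k" "real g \<le> real k + 1 - c / hbar" using q k unfolding g_def by linarith+
    have nbar_ge: "m \<le> nbar m" if "m \<ge> 1" for m
      using that
    proof (induction m rule: dec_induct)
      case base
      then show ?case using assms(5)[of 1] by simp
    next
      case (step m)
      then have "nbar m < nbar (Suc m)" using assms(4) by (auto simp: strict_mono_on_def)
      then show ?case using step by simp
    qed
    have L1: "L1_norm {a..a + 1} (power_function H ip X) \<le> ?B (nbar (k - j))"
      if j: "j < g" and X: "X \<inter> {a..a + 1} = (\<lambda>y. y + a) ` Y (k - j)" for a j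
    proof -
      let ?n = "real (nbar (k - j))" and ?h = "fill_distance X {a..a + 1}"
      have j': "k - j \<ge> 1" using j g by simp
      \<comment> \<open>From \<open>j \<le> g - 1\<close> follows
        \<open>k - j \<ge> k + 1 - g\<close>, which is at least \<open>c / hbar\<close> by the
        choice of \<open>g\<close>.\<close>
      have "c / hbar \<le> real (k - j)" using j g by (simp add: of_nat_diff)
      also have "\<dots> \<le> ?n" using nbar_ge[OF j'] by simp
      finally have n: "c / hbar \<le> ?n" .
      then have n0: "0 < ?n" using q by simp
      have c_n: "c / ?n \<le> hbar" using n n0 hbar by (simp add: field_simps)
      have "c\<^sup>2 \<le> c / hbar"
        using hbar assms(7) by (simp add: field_simps power2_eq_square)
      then have n_c: "c\<^sup>2 \<le> ?n" using n by simp
      have le: "?h \<le> ereal (c / ?n)"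
        by (rule fill_distance_translate_le[OF Y01[OF j'] X assms(8)[OF j']])
      moreover have "0 < ?h" by (rule fill_distance_pos[OF finX]) simp
      \<comment> \<open>Positivity and the finite upper bound make the extended-real fill distance
        an actual positive real.\<close>
      ultimately obtain h where h: "?h = ereal h" "0 < h" "h \<le> c / ?n"
        by (cases ?h) auto
      have "?h \<le> ereal h0" using h c_n hbar by simp
      from assms(12)[OF finX this]
      have "L1_norm {a..a + 1} (power_function H ip X) \<le> exp (C * ln h / h)"
        by (simp add: h(1))
      also have "\<dots> \<le> ?B (nbar (k - j))"
      proof (rule exp_fill_distance_le)
        show "c / ?n \<le> 1" using c_n hbar(2) assms(11) by linarith
      qed (use h n_c n0 assms in auto)
      finally show ?thesis .
    qed
    have "worst_case_error \<alpha> H ip (opt_quadrature \<alpha> H ip X) \<le> gauss_integral \<alpha> (power_function H ip X)"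
      by (rule worst_case_error_opt_quadrature_le[OF finX assms(1)])
    also have "\<dots> \<le> exp (- (real g)\<^sup>2 / (2 * \<alpha>\<^sup>2)) + sqrt 2 / (sqrt pi * \<alpha>)
        * (\<Sum>j<g. exp (- (real j)\<^sup>2 / (2 * \<alpha>\<^sup>2)) * ?B (nbar (k - j)))"
    proof (rule gauss_integral_split_le[OF assms(1) borel_measurable_power_function[OF finX]
          power_function_nonneg[OF finX] power_function_le_1[OF finX]])
      fix j assume j: "j < g"
      then have "j < k" using g by simp
      then show "L1_norm {real j..real j + 1} (power_function H ip X) \<le> ?B (nbar (k - j))"
        using L1[OF j, of "real j"] point_set_Int_pos[OF Y01 finY] by (simp add: X_def)
      show "L1_norm {- real j - 1..- real j} (power_function H ip X) \<le> ?B (nbar (k - j))"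
        using L1[OF j, of "- real j - 1"] point_set_Int_neg[OF Y01 finY \<open>j < k\<close>] by (simp add: X_def)
    qed
    also have "(\<Sum>j<g. exp (- (real j)\<^sup>2 / (2 * \<alpha>\<^sup>2)) * ?B (nbar (k - j)))
        = (\<Sum>m=k - g + 1..k. exp (- ((real k - real m)\<^sup>2 / (2 * \<alpha>\<^sup>2)
            + C / (2 * c) * real (nbar m) * ln (real (nbar m)))))"
      \<comment> \<open>The substitution \<open>m = k - j\<close> is a bijection because
        \<open>g \<le> k\<close>, so natural subtraction is exact.\<close>
      by (rule sum.reindex_bij_witness[of _ "\<lambda>m. k - m" "\<lambda>j. k - j"])
         (use g in \<open>auto simp: exp_add[symmetric]\<close>)
    finally show ?thesis .
  qed
  then show ?thesis
    using card unfolding X_def g_def hbar_def Let_def by blast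
qed

end
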